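(* Let $E=[\mathbf b_0,\mathbf a_0]\setminus\bigcup_{j=1}^g(\mathbf a_j,\mathbf b_j)$ be a finite system of intervals. Then there exists a unique rational function $\Delta(z)$ with $\Delta(\infty)=\infty$ such that $$E=\Delta^{-1}([-2,2])$$ and $\mathrm{Im}\,\Delta(z)>0$ for $\mathrm{Im}\,z>0$.
   Context: Here $g\ge0$, $\mathbf b_0<\mathbf a_0$ are real, and the gaps $(\mathbf a_j,\mathbf b_j)$, $1\le j\le g$, are nonempty open intervals with pairwise disjoint closures contained in $(\mathbf b_0,\mathbf a_0)$, so that $E$ consists of $g+1$ disjoint nondegenerate closed intervals. $\Delta^{-1}([-2,2])$ is the full preimage in $\overline{\mathbb C}$. *)

theory Defs
  imports "HOL-Analysis.Analysis" "HOL-Computational_Algebra.Computational_Algebra"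
    "HOL-Computational_Algebra.Field_as_Ring"
begin

text \<open>
  The Riemann sphere is the one-point compactification of the complex plane. Following
  \<^const>\<open>Alexandroff_compactification\<close>, its points are \<^term>\<open>Some z\<close> for complex \<open>z\<close>,
  and \<^term>\<open>None\<close> for the point at infinity.
\<close>

type_synonym riemann_sphere = "complex option"

abbreviation sphere_infinity :: riemann_sphere where
  "sphere_infinity \<equiv> None"

abbreviation real_to_sphere :: "real \<Rightarrow> riemann_sphere" where
  "real_to_sphere x \<equiv> Some (complex_of_real x)"

text \<open>
  Rational functions are elements of the fraction field of \<^typ>\<open>complex poly\<close>. The function
  \<^const>\<open>quot_of_fract\<close> yields numerator and denominator in lowest terms (with monic
  denominator), so numerator and denominator have no common zero and every zero of the
  denominator is a pole. The value at infinity is the limit of \<open>p(z) / q(z)\<close> for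
  \<open>z \<rightarrow> \<infinity>\<close>; if \<open>degree p < degree q\<close>, then \<open>coeff p (degree q)\<close> is zero.
\<close>

definition sphere_map :: "complex poly fract \<Rightarrow> riemann_sphere \<Rightarrow> riemann_sphere" where
  "sphere_map R z =
     (let (p, q) = quot_of_fract R in
      case z of
        Some w \<Rightarrow> if poly q w = 0 then sphere_infinity else Some (poly p w / poly q w)
      | None \<Rightarrow> if degree p > degree q then sphere_infinity
                else Some (coeff p (degree q) / lead_coeff q))"

end

theory Submission
  imports Defs
begin

text \<open>
  Let \<open>A = (z - a\<^sub>0)\<dots>(z - a\<^sub>g)\<close> and \<open>B = (z - b\<^sub>0)\<dots>(z - b\<^sub>g)\<close>, whose zeros are the right and
  the left end points of the intervals. The function is \<open>\<Delta> = 2 (A + B) / (B - A)\<close>, equivalently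
  \<open>(\<Delta> - 2) / (\<Delta> + 2) = A / B\<close>. It maps the upper half plane to itself since \<open>A / B = 1 - \<Sum>\<^sub>i c\<^sub>i / (z - b\<^sub>i)\<close>
  with \<open>c\<^sub>i > 0\<close>, and for real \<open>x\<close> we have \<open>\<bar>\<Delta> x\<bar> \<le> 2\<close> iff \<open>A x * B x \<le> 0\<close> iff \<open>x \<in> E\<close>.

  Conversely, let \<open>P / Q\<close> be such a function in lowest terms. It is real on the infinite set \<open>E\<close>, hence
  on the real axis, and it is locally strictly increasing there: near a real point with real value \<open>c\<close>,
  \<open>P / Q - c\<close> behaves like \<open>s (z - x)\<^sup>m\<close>, which maps the upper half disc to the upper half plane only if
  \<open>m = 1\<close> and \<open>s > 0\<close>. So on \<open>E\<close> the value \<open>2\<close> is taken exactly at the right end points and \<open>-2\<close>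
  exactly at the left ones, always simply, which gives \<open>P - 2 Q = k A\<close> and \<open>P + 2 Q = k B\<close>.
\<close>

section \<open>Complex polynomials without common zeros, and evaluation of their quotients on the
  sphere\<close>

lemma coprime_complex_polyI:
  fixes p q :: "complex poly"
  assumes "q \<noteq> 0" "\<And>z. poly p z = 0 \<Longrightarrow> poly q z \<noteq> 0"
  shows "coprime p q"
proof (rule coprimeI)
  fix d assume d: "d dvd p" "d dvd q"
  have "constant (poly d)"
    using fundamental_theorem_of_algebra[of d] assms(2) d by (meson poly_eq_0_iff_dvd dvd_trans)
  then have "degree d = 0"
    by (simp add: constant_degree)
  moreover have "d \<noteq> 0"
    using d assms by auto
  ultimately show "is_unit d"
    by (simp add: is_unit_iff_degree)
qed

text \<open>A coprime pair is already in lowest terms, so normalisation only rescales it to make the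
  denominator monic.\<close>

lemma quot_of_fract_coprime:
  fixes p q :: "complex poly"
  assumes "coprime p q" "q \<noteq> 0"
  defines "k \<equiv> inverse (lead_coeff q)"
  shows "quot_of_fract (quot_to_fract (p, q)) = (smult k p, smult k q)"
proof -
  have k: "k \<noteq> 0"
    using assms by simp
  have "coprime (smult k p) (smult k q)"
    using assms(1) k by (simp add: coprime_def dvd_smult_iff)
  moreover have "unit_factor (smult k q) = 1"
    using assms k by (simp add: unit_factor_poly_def)
  ultimately have "normalize_quot (p, q) = (smult k p, smult k q)"
    using assms by (intro normalize_quotI) (auto simp: normalized_fracts_def mult.commute)
  then show ?thesis
    by (simp add: quot_of_fract_quot_to_fract)
qed

lemma sphere_map_coprime:
  assumes "coprime p q" "q \<noteq> 0"
  shows "sphere_map (quot_to_fract (p, q)) (Some z) =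
           (if poly q z = 0 then sphere_infinity else Some (poly p z / poly q z))"
    and "degree q < degree p \<Longrightarrow>
           sphere_map (quot_to_fract (p, q)) sphere_infinity = sphere_infinity"
  using assms by (simp_all add: sphere_map_def quot_of_fract_coprime)

section \<open>Behaviour of a rational self-map of the upper half plane at real points\<close>

text \<open>Approach \<open>x\<close> along the ray of angle \<open>\<phi> / m\<close>. There
  \<open>P / Q - c\<close> is \<open>t ^ m * cis \<phi> * (R / Q)\<close>, and \<open>c\<close> is
  real, so \<open>cis \<phi> * (R / Q)\<close> has positive imaginary part; let \<open>t\<close>
  tend to 0. The ray lies in the open half plane only for \<open>\<phi>\<close> strictly between 0
  and \<open>m * pi\<close>; the two end values follow by continuity.\<close>

lemma Im_boundary_factor_nonneg:
  fixes P Q R :: "complex poly" and x c \<phi> :: real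
  assumes upper: "\<And>z. Im z > 0 \<Longrightarrow> Im (poly P z / poly Q z) > 0"
    and fac: "P - smult (of_real c) Q = [:- of_real x, 1:] ^ m * R"
    and Qx: "poly Q (of_real x) \<noteq> 0"
    and m: "m > 0" and \<phi>: "0 \<le> \<phi>" "\<phi> \<le> m * pi"
  shows "Im (cis \<phi> * (poly R (of_real x) / poly Q (of_real x))) \<ge> 0"
proof -
  let ?s = "poly R (of_real x) / poly Q (of_real x)"
  have inner: "Im (cis \<phi> * ?s) \<ge> 0" if "\<phi> \<in> {0<..<m * pi}" for \<phi>
  proof -
    define \<theta> where "\<theta> = \<phi> / m"
    have \<theta>: "0 < \<theta>" "\<theta> < pi" "m * \<theta> = \<phi>"
      using that m by (auto simp: \<theta>_def field_simps)
    define h where "h t = x + of_real t * cis \<theta>" for t :: real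
    have lim: "((\<lambda>t. Im (cis \<phi> * (poly R (h t) / poly Q (h t)))) \<longlongrightarrow> Im (cis \<phi> * ?s)) (at_right 0)"
      unfolding h_def by (rule tendsto_eq_intros refl | use Qx in simp)+
    have "Im (cis \<phi> * (poly R (h t) / poly Q (h t))) \<ge> 0" if "t > 0" for t
    proof -
      have "Im (h t) > 0"
        using that \<theta> by (simp add: h_def sin_gt_zero)
      then have pos: "Im (poly P (h t) / poly Q (h t)) > 0"
        by (rule upper)
      then have Q: "poly Q (h t) \<noteq> 0"
        by auto
      define W where "W = cis \<phi> * (poly R (h t) / poly Q (h t))"
      have "poly P (h t) - c * poly Q (h t) = (h t - x) ^ m * poly R (h t)"
        using arg_cong[OF fac, of "\<lambda>p. poly p (h t)"] by (simp add: poly_power)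
      also have "h t - x = of_real t * cis \<theta>"
        by (simp add: h_def)
      also have "(of_real t * cis \<theta>) ^ m = of_real (t ^ m) * cis \<phi>"
        using \<theta>(3) by (simp add: power_mult_distrib Complex.DeMoivre)
      finally have "poly P (h t) - c * poly Q (h t) = of_real (t ^ m) * cis \<phi> * poly R (h t)" .
      then have "(poly P (h t) - c * poly Q (h t)) / poly Q (h t) = of_real (t ^ m) * W"
        by (simp only: W_def mult.assoc times_divide_eq_right)
      then have "poly P (h t) / poly Q (h t) = c + of_real (t ^ m) * W"
        using Q by (simp add: diff_divide_distrib diff_eq_eq add.commute)
      then have "Im (poly P (h t) / poly Q (h t)) = t ^ m * Im W"
        by (simp del: of_real_power)
      then show ?thesis
        using pos that by (simp add: zero_less_mult_iff W_def)
    qed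
    then have "\<forall>\<^sub>F t in at_right 0. Im (cis \<phi> * (poly R (h t) / poly Q (h t))) \<ge> 0"
      by (auto simp: eventually_at_filter)
    then show ?thesis
      using tendsto_lowerbound[OF lim] by simp
  qed
  have "\<phi> \<in> closure {0<..<m * pi}"
    using m \<phi> by (simp add: closure_greaterThanLessThan)
  then show ?thesis
    by (rule continuous_ge_on_closure[rotated, where f = "\<lambda>\<phi>. Im (cis \<phi> * ?s)"])
      (use inner Qx in \<open>auto intro!: continuous_intros\<close>)
qed

text \<open>Angles 0 and \<open>pi\<close> show that \<open>s = R x / Q x\<close> is real, angle
  \<open>pi / 2\<close> that it is nonnegative. If \<open>m\<close> were at least 2, the angle
  \<open>3 * pi / 2\<close> would be admissible too, and it gives \<open>- Re s\<close>.\<close>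

lemma boundary_zero_simple:
  fixes P Q R :: "complex poly" and x c :: real
  assumes upper: "\<And>z. Im z > 0 \<Longrightarrow> Im (poly P z / poly Q z) > 0"
    and fac: "P - smult (of_real c) Q = [:- of_real x, 1:] ^ m * R"
    and Qx: "poly Q (of_real x) \<noteq> 0" and Rx: "poly R (of_real x) \<noteq> 0"
    and m: "m > 0"
  shows "m = 1" and "Re (poly R (of_real x) / poly Q (of_real x)) > 0"
proof -
  define s where "s = poly R (of_real x) / poly Q (of_real x)"
  have nonneg: "Im (cis \<phi> * s) \<ge> 0" if "0 \<le> \<phi>" "\<phi> \<le> m * pi" for \<phi>
    unfolding s_def by (rule Im_boundary_factor_nonneg[OF upper fac Qx m that])
  have "1 * pi \<le> m * pi"
    by (rule mult_right_mono) (use m in auto)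
  then have "Im s \<ge> 0" "- Im s \<ge> 0" "Re s \<ge> 0"
    using nonneg[of 0] nonneg[of pi] nonneg[of "pi / 2"] by auto
  moreover have "s \<noteq> 0"
    using Qx Rx by (simp add: s_def)
  ultimately have "Re s > 0"
    by (simp add: complex_eq_iff)
  then show "Re (poly R (of_real x) / poly Q (of_real x)) > 0"
    by (simp add: s_def)
  show "m = 1"
  proof (rule ccontr)
    assume "m \<noteq> 1"
    then have "2 * pi \<le> m * pi"
      by (intro mult_right_mono) (use m in auto)
    moreover have "cis (3 * pi / 2) = - \<i>"
      using cis_mult[of pi "pi / 2"] by (simp add: field_simps)
    ultimately show False
      using nonneg[of "3 * pi / 2"] \<open>Re s > 0\<close> by simp
  qed
qed

text \<open>By simplicity of the zero, \<open>P / Q - c\<close> is \<open>(y - x) * (R / Q)\<close>,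
  where \<open>R / Q\<close> has positive real part at \<open>x\<close> and hence nearby; the sign
  is that of \<open>y - x\<close>.\<close>

lemma boundary_increasing:
  fixes P Q :: "complex poly" and x c :: real
  assumes upper: "\<And>z. Im z > 0 \<Longrightarrow> Im (poly P z / poly Q z) > 0"
    and Qx: "poly Q (of_real x) \<noteq> 0" and val: "poly P (of_real x) / poly Q (of_real x) = of_real c"
  shows "order (of_real x) (P - smult (of_real c) Q) = 1"
    and "\<forall>\<^sub>F y in at_right x. Re (poly P (of_real y) / poly Q (of_real y)) > c"
    and "\<forall>\<^sub>F y in at_left x. Re (poly P (of_real y) / poly Q (of_real y)) < c"
proof -
  let ?D = "P - smult (of_real c) Q"
  \<comment> \<open>Otherwise \<open>P / Q\<close> would have a real value at
    \<open>\<i>\<close>.\<close>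
  have "?D \<noteq> 0"
  proof
    assume "?D = 0"
    then have "poly P \<i> = c * poly Q \<i>"
      by (metis diff_eq_diff_eq eq_iff_diff_eq_0 poly_smult)
    then show False
      using upper[of \<i>] by (auto split: if_splits)
  qed
  then obtain R where R: "?D = [:- of_real x, 1:] ^ order (of_real x) ?D * R"
      "\<not> [:- of_real x, 1:] dvd R"
    using order_decomp by blast
  have Rx: "poly R (of_real x) \<noteq> 0"
    using R(2) by (simp add: poly_eq_0_iff_dvd)
  have "order (of_real x) ?D > 0"
    using \<open>?D \<noteq> 0\<close> Qx val by (simp add: order_gt_0_iff field_simps)
  note simple = boundary_zero_simple[OF upper R(1) Qx Rx this]
  show "order (of_real x) ?D = 1"
    by (rule simple(1))
  then have D: "?D = [:- of_real x, 1:] * R"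
    using R(1) by simp
  let ?f = "\<lambda>y::real. Re (poly P (of_real y) / poly Q (of_real y))"
  let ?s = "\<lambda>y::real. Re (poly R (of_real y) / poly Q (of_real y))"
  have f: "?f y - c = (y - x) * ?s y" if "poly Q (of_real y) \<noteq> 0" for y
  proof -
    have "poly P (of_real y) - c * poly Q (of_real y) = of_real (y - x) * poly R (of_real y)"
      using arg_cong[OF D, of "\<lambda>p. poly p (of_real y)"] by (simp add: algebra_simps)
    then have "poly P (of_real y) / poly Q (of_real y) =
        c + of_real (y - x) * (poly R (of_real y) / poly Q (of_real y))"
      using that by (simp add: field_simps)
    then have "?f y = Re (c + of_real (y - x) * (poly R (of_real y) / poly Q (of_real y)))"
      by (rule arg_cong)
    also have "\<dots> = c + (y - x) * ?s y"
      by (simp del: of_real_diff times_divide_eq_right)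
    finally show ?thesis
      by simp
  qed
  have "(?s \<longlongrightarrow> ?s x) (at x)" "((\<lambda>y. poly Q (of_real y)) \<longlongrightarrow> poly Q (of_real x)) (at x)"
    by (rule tendsto_eq_intros refl | use Qx in simp)+
  then have "\<forall>\<^sub>F y in at x. ?s y > 0" "\<forall>\<^sub>F y in at x. poly Q (of_real y) \<noteq> 0"
    using simple(2) Qx by (auto dest: order_tendstoD(1) tendsto_imp_eventually_ne)
  then have ev: "\<forall>\<^sub>F y in at x. ?s y > 0 \<and> poly Q (of_real y) \<noteq> 0"
    by (rule eventually_conj)
  show "\<forall>\<^sub>F y in at_right x. ?f y > c"
    using ev unfolding eventually_at_split eventually_at_filter
    by (auto elim!: eventually_mono) (smt (verit) f mult_pos_pos)
  show "\<forall>\<^sub>F y in at_left x. ?f y < c"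
    using ev unfolding eventually_at_split eventually_at_filter
    by (auto elim!: eventually_mono) (smt (verit) f mult_neg_pos)
qed

text \<open>If \<open>P / Q\<close> is real at \<open>x\<close>, then \<open>P * cnj Q - cnj P * Q\<close> vanishes there, and it is a polynomial.\<close>

lemma rational_real_on_reals:
  fixes P Q :: "complex poly"
  assumes "infinite S" "\<And>x. x \<in> S \<Longrightarrow> poly P (of_real x) / poly Q (of_real x) \<in> \<real>"
  shows "poly P (of_real x) / poly Q (of_real x) \<in> \<real>"
proof -
  let ?D = "P * map_poly cnj Q - map_poly cnj P * Q"
  \<comment> \<open>At a zero of \<open>Q\<close> both sides hold, since the quotient is 0 there by
    convention.\<close>
  have iff: "poly ?D (of_real x) = 0 \<longleftrightarrow> poly P (of_real x) / poly Q (of_real x) \<in> \<real>" for x :: real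
    by (cases "poly Q (of_real x) = 0") (auto simp: Reals_cnj_iff field_simps)
  have "infinite (complex_of_real ` S)"
    using assms(1) by (simp add: finite_image_iff inj_on_def)
  moreover have "complex_of_real ` S \<subseteq> {z. poly ?D z = 0}"
    using assms(2) iff by blast
  ultimately have "?D = 0"
    using poly_roots_finite finite_subset by blast
  then show ?thesis
    using iff by simp
qed

section \<open>The end points of the intervals and the local shape of \<open>E\<close>\<close>

text \<open>Index 0 carries the outer end points, in the order opposite to that of a gap. Thus for
  every \<open>j \<le> g\<close>, including 0, \<open>a j\<close> is the right end of a component of
  \<open>E\<close> and \<open>b j\<close> the left end of one. The gaps are not assumed to be
  numbered from left to right.\<close>

locale interval_system =
  fixes g :: nat and a b :: "nat \<Rightarrow> real"
  assumes ends: "b 0 < a 0"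
    and gap: "0 < j \<Longrightarrow> j \<le> g \<Longrightarrow> a j < b j"
    and inside: "0 < j \<Longrightarrow> j \<le> g \<Longrightarrow> b 0 < a j \<and> b j < a 0"
    and disjoint: "0 < i \<Longrightarrow> i \<le> g \<Longrightarrow> 0 < j \<Longrightarrow> j \<le> g \<Longrightarrow> i \<noteq> j \<Longrightarrow> b i < a j \<or> b j < a i"
begin

definition E :: "real set" where
  "E = {b 0..a 0} - (\<Union>j\<in>{1..g}. {a j<..<b j})"

definition A :: "complex poly" where
  "A = (\<Prod>j\<le>g. [:- of_real (a j), 1:])"

definition B :: "complex poly" where
  "B = (\<Prod>j\<le>g. [:- of_real (b j), 1:])"

lemma in_E_iff: "x \<in> E \<longleftrightarrow> b 0 \<le> x \<and> x \<le> a 0 \<and> (\<forall>j\<in>{1..g}. x \<le> a j \<or> b j \<le> x)"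
  by (auto simp: E_def not_less)

lemma a_neq_b:
  assumes "i \<le> g" "j \<le> g"
  shows "a i \<noteq> b j"
proof -
  consider "i = 0" "j = 0" | "i = 0" "j > 0" | "i > 0" "j = 0" | "i > 0" "j > 0" "i = j"
    | "i > 0" "j > 0" "i \<noteq> j"
    by blast
  then show ?thesis
    using ends gap[of i] gap[of j] inside[of i] inside[of j] disjoint[of i j] assms
    by cases auto
qed

lemma inj_on_a: "inj_on a {..g}"
proof (rule linorder_inj_onI')
  fix i j assume "i \<in> {..g}" "j \<in> {..g}" "i < j"
  then show "a i \<noteq> a j"
    using gap[of i] gap[of j] inside[of j] disjoint[of i j] by (cases "i = 0") auto
qed

lemma inj_on_b: "inj_on b {..g}"
proof (rule linorder_inj_onI')
  fix i j assume "i \<in> {..g}" "j \<in> {..g}" "i < j"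
  then show "b i \<noteq> b j"
    using gap[of i] gap[of j] inside[of j] disjoint[of i j] by (cases "i = 0") auto
qed

lemma a_in_E:
  assumes "i \<le> g"
  shows "a i \<in> E"
proof -
  have "a i \<le> a j \<or> b j \<le> a i" if "j \<in> {1..g}" for j
    using assms that gap[of i] inside[of j] disjoint[of i j] by (cases "i = 0"; cases "i = j") auto
  moreover have "b 0 \<le> a i" "a i \<le> a 0"
    using assms ends gap[of i] inside[of i] by (cases "i = 0"; auto)+
  ultimately show ?thesis
    by (simp add: in_E_iff)
qed

lemma b_in_E:
  assumes "i \<le> g"
  shows "b i \<in> E"
proof -
  have "b i \<le> a j \<or> b j \<le> b i" if "j \<in> {1..g}" for j
    using assms that gap[of i] inside[of j] disjoint[of i j] by (cases "i = 0"; cases "i = j") auto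
  moreover have "b 0 \<le> b i" "b i \<le> a 0"
    using assms ends gap[of i] inside[of i] by (cases "i = 0"; auto)+
  ultimately show ?thesis
    by (simp add: in_E_iff)
qed

text \<open>Each of the finitely many gaps either begins strictly to the right of \<open>x\<close>,
  as \<open>x\<close> is no \<open>a j\<close>, or has ended at \<open>x\<close> or before; likewise
  \<open>x < a 0\<close>.\<close>

lemma eventually_in_E_right:
  assumes "x \<in> E" "x \<notin> a ` {..g}"
  shows "\<forall>\<^sub>F y in at_right x. y \<in> E"
proof -
  have gt: "\<forall>\<^sub>F y in at_right x. x < y"
    by (rule eventually_at_right_less)
  have lt: "\<forall>\<^sub>F y in at_right x. y < a j" if "j \<le> g" "x \<le> a j" for j
    using that assms(2) order_tendstoD(2)[OF tendsto_ident_at, of x "a j" "{x<..}"]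
    by (cases "x = a j") auto
  have "\<forall>\<^sub>F y in at_right x. y \<le> a j \<or> b j \<le> y" if "j \<in> {1..g}" for j
  proof (cases "x \<le> a j")
    case True
    then show ?thesis
      using lt[of j] that by (auto elim: eventually_mono)
  next
    case False
    then have "b j \<le> x"
      using assms(1) that by (auto simp: in_E_iff)
    then show ?thesis
      using gt by (auto elim: eventually_mono)
  qed
  then have "\<forall>\<^sub>F y in at_right x. \<forall>j\<in>{1..g}. y \<le> a j \<or> b j \<le> y"
    by (intro eventually_ball_finite) auto
  moreover have "\<forall>\<^sub>F y in at_right x. y < a 0"
    using lt[of 0] assms(1) by (auto simp: in_E_iff)
  ultimately show ?thesis
    using gt by eventually_elim (use assms(1) in \<open>auto simp: in_E_iff\<close>)
qed

lemma eventually_in_E_left: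
  assumes "x \<in> E" "x \<notin> b ` {..g}"
  shows "\<forall>\<^sub>F y in at_left x. y \<in> E"
proof -
  have lt: "\<forall>\<^sub>F y in at_left x. y < x"
    by (simp add: eventually_at_filter)
  have gt: "\<forall>\<^sub>F y in at_left x. b j < y" if "j \<le> g" "b j \<le> x" for j
    using that assms(2) order_tendstoD(1)[OF tendsto_ident_at, of "b j" x "{..<x}"]
    by (cases "x = b j") auto
  have "\<forall>\<^sub>F y in at_left x. y \<le> a j \<or> b j \<le> y" if "j \<in> {1..g}" for j
  proof (cases "b j \<le> x")
    case True
    then show ?thesis
      using gt[of j] that by (auto elim: eventually_mono)
  next
    case False
    then have "x \<le> a j"
      using assms(1) that by (auto simp: in_E_iff)
    then show ?thesis
      using lt by (auto elim: eventually_mono)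
  qed
  then have "\<forall>\<^sub>F y in at_left x. \<forall>j\<in>{1..g}. y \<le> a j \<or> b j \<le> y"
    by (intro eventually_ball_finite) auto
  moreover have "\<forall>\<^sub>F y in at_left x. b 0 < y"
    using gt[of 0] assms(1) by (auto simp: in_E_iff)
  ultimately show ?thesis
    using lt by eventually_elim (use assms(1) in \<open>auto simp: in_E_iff\<close>)
qed

lemma eventually_notin_E_right:
  assumes "j \<le> g"
  shows "\<forall>\<^sub>F y in at_right (a j). y \<notin> E"
proof (cases "j = 0")
  case True
  show ?thesis
    using eventually_at_right_less[of "a j"]
    by eventually_elim (use True in \<open>auto simp: in_E_iff\<close>)
next
  case False
  then have "a j < b j"
    using gap assms by simp
  from eventually_at_right_real[OF this] show ?thesis
    by eventually_elim (use False assms in \<open>auto simp: E_def\<close>)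
qed

lemma eventually_notin_E_left:
  assumes "j \<le> g"
  shows "\<forall>\<^sub>F y in at_left (b j). y \<notin> E"
proof (cases "j = 0")
  case True
  have "\<forall>\<^sub>F y in at_left (b j). y < b j"
    by (simp add: eventually_at_filter)
  then show ?thesis
    by eventually_elim (use True in \<open>auto simp: in_E_iff\<close>)
next
  case False
  then have "a j < b j"
    using gap assms by simp
  from eventually_at_left_real[OF this] show ?thesis
    by eventually_elim (use False assms in \<open>auto simp: E_def\<close>)
qed

lemma infinite_E: "infinite E"
proof -
  have "b 0 \<in> E" "b 0 \<notin> a ` {..g}"
    using b_in_E a_neq_b[of _ 0] by force+
  from eventually_in_E_right[OF this] obtain c where c: "c > b 0" "\<And>y. b 0 < y \<Longrightarrow> y < c \<Longrightarrow> y \<in> E"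
    by (auto simp: eventually_at_right_field)
  then have "{b 0<..<c} \<subseteq> E"
    by auto
  then show ?thesis
    using c(1) infinite_Ioo infinite_super by blast
qed

section \<open>The polynomials vanishing at the right and at the left end points\<close>

lemma monic_A: "degree A = Suc g" "coeff A (Suc g) = 1"
proof -
  show "degree A = Suc g"
    by (simp add: A_def degree_prod_sum_eq)
  moreover have "lead_coeff A = 1"
    unfolding A_def lead_coeff_prod by simp
  ultimately show "coeff A (Suc g) = 1"
    by simp
qed

lemma monic_B: "degree B = Suc g" "coeff B (Suc g) = 1"
proof -
  show "degree B = Suc g"
    by (simp add: B_def degree_prod_sum_eq)
  moreover have "lead_coeff B = 1"
    unfolding B_def lead_coeff_prod by simp
  ultimately show "coeff B (Suc g) = 1"
    by simp
qed

lemma poly_A_eq_0_iff: "poly A z = 0 \<longleftrightarrow> z \<in> of_real ` a ` {..g}"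
  by (auto simp: A_def poly_prod)

lemma poly_B_eq_0_iff: "poly B z = 0 \<longleftrightarrow> z \<in> of_real ` b ` {..g}"
  by (auto simp: B_def poly_prod)

text \<open>Simple zeros and a known zero set determine a polynomial up to a factor. With its
  counterpart for \<open>B\<close>, this identifies \<open>P - 2 Q\<close> and
  \<open>P + 2 Q\<close> in the uniqueness proof.\<close>

lemma rsquarefree_eq_A:
  assumes "rsquarefree p" "{z. poly p z = 0} = of_real ` a ` {..g}"
  shows "p = smult (lead_coeff p) A"
proof -
  have "A = (\<Prod>z\<in>of_real ` a ` {..g}. [:- z, 1:])"
    using inj_on_a by (simp add: A_def prod.reindex inj_on_def image_image)
  then show ?thesis
    using complex_poly_decompose_rsquarefree[OF assms(1)] assms(2) by simp
qed

lemma rsquarefree_eq_B: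
  assumes "rsquarefree p" "{z. poly p z = 0} = of_real ` b ` {..g}"
  shows "p = smult (lead_coeff p) B"
proof -
  have "B = (\<Prod>z\<in>of_real ` b ` {..g}. [:- z, 1:])"
    using inj_on_b by (simp add: B_def prod.reindex inj_on_def image_image)
  then show ?thesis
    using complex_poly_decompose_rsquarefree[OF assms(1)] assms(2) by simp
qed

section \<open>Partial fractions of \<open>A / B\<close>\<close>

definition residue_weight :: "nat \<Rightarrow> real" where
  "residue_weight i = (a i - b i) * (\<Prod>j\<in>{..g} - {i}. (b i - a j) / (b i - b j))"

text \<open>
  The weight \<open>residue_weight i\<close> is minus the residue of \<open>A / B\<close> at \<open>b i\<close>. The gaps need not be ordered to
  find its sign: \<open>b i\<close> lies on the same side of both end points of every other gap, and strictly
  between \<open>b 0\<close> and \<open>a 0\<close> if \<open>i > 0\<close>.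
\<close>

lemma residue_weight_pos:
  assumes "i \<le> g"
  shows "residue_weight i > 0"
proof (cases "i = 0")
  case True
  have "(b 0 - a j) / (b 0 - b j) > 0" if "j \<in> {..g} - {0}" for j
    using that gap[of j] inside[of j] by (intro divide_neg_neg) auto
  then have "(\<Prod>j\<in>{..g} - {0}. (b 0 - a j) / (b 0 - b j)) > 0"
    by (rule prod_pos)
  then show ?thesis
    using True ends by (simp add: residue_weight_def)
next
  case False
  have "(b i - a j) / (b i - b j) > 0" if "j \<in> {..g} - {i} - {0}" for j
    using that assms False gap[of i] gap[of j] disjoint[of i j]
    by (cases "b i < a j") (auto simp: zero_less_divide_iff)
  then have "(\<Prod>j\<in>{..g} - {i} - {0}. (b i - a j) / (b i - b j)) > 0"
    by (rule prod_pos)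
  \<comment> \<open>This is the only negative factor of the product; its sign cancels against that
    of \<open>a i - b i\<close>.\<close>
  moreover have "(b i - a 0) / (b i - b 0) < 0"
    using False assms gap[of i] inside[of i] by (intro divide_neg_pos) auto
  moreover have "(\<Prod>j\<in>{..g} - {i}. (b i - a j) / (b i - b j)) =
      (b i - a 0) / (b i - b 0) * (\<Prod>j\<in>{..g} - {i} - {0}. (b i - a j) / (b i - b j))"
    using False by (intro prod.remove) auto
  ultimately have "(\<Prod>j\<in>{..g} - {i}. (b i - a j) / (b i - b j)) < 0"
    by (simp only: mult_neg_pos)
  moreover have "a i - b i < 0"
    using False assms gap[of i] by simp
  ultimately show ?thesis
    unfolding residue_weight_def by (simp only: mult_neg_neg)
qed

text \<open>This is the partial fraction expansion of \<open>A / B\<close> with denominators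
  cleared. Both sides are monic of degree \<open>g + 1\<close>, so it suffices to compare them at
  the \<open>g + 1\<close> distinct zeros of \<open>B\<close>.\<close>

lemma B_partial_fraction:
  "B = A + (\<Sum>i\<le>g. smult (of_real (residue_weight i)) (\<Prod>j\<in>{..g} - {i}. [:- of_real (b j), 1:]))"
  (is "_ = A + (\<Sum>i\<le>g. ?T i)")
proof (rule poly_eqI_degree_lead_coeff[where n = "Suc g" and A = "of_real ` b ` {..g}"])
  have T: "degree (?T i) \<le> g" if "i \<le> g" for i
    using that by (simp add: degree_prod_sum_eq)
  then have deg: "degree (\<Sum>i\<le>g. ?T i) \<le> g"
    by (intro degree_sum_le) auto
  then show "degree (A + (\<Sum>i\<le>g. ?T i)) \<le> Suc g"
    using monic_A by (intro degree_add_le) auto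
  show "degree B \<le> Suc g"
    using monic_B by simp
  have "coeff (\<Sum>i\<le>g. ?T i) (Suc g) = 0"
    using deg by (intro coeff_eq_0) simp
  then show "coeff B (Suc g) = coeff (A + (\<Sum>i\<le>g. ?T i)) (Suc g)"
    using monic_A monic_B by simp
  show "Suc g \<le> card (complex_of_real ` b ` {..g})"
    using inj_on_b by (simp add: card_image inj_on_def)
next
  fix z :: complex assume "z \<in> of_real ` b ` {..g}"
  then obtain i where i: "i \<le> g" "z = of_real (b i)"
    by auto
  have "poly (?T k) z = 0" if "k \<in> {..g} - {i}" for k
    using that i by (auto simp: poly_prod)
  then have "(\<Sum>k\<in>{..g} - {i}. poly (?T k) z) = 0"
    by (rule sum.neutral[OF ballI])
  then have "poly (\<Sum>k\<le>g. ?T k) z = poly (?T i) z"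
    using i by (simp add: poly_sum sum.remove[of _ i])
  also have "\<dots> = of_real (residue_weight i * (\<Prod>j\<in>{..g} - {i}. b i - b j))"
    using i by (simp add: poly_prod)
  \<comment> \<open>The factors \<open>b i - b j\<close> are nonzero and cancel;
    \<open>a i - b i\<close> then supplies, up to sign, the factor missing from the value of
    \<open>A\<close> at \<open>b i\<close>.\<close>
  also have "residue_weight i * (\<Prod>j\<in>{..g} - {i}. b i - b j) = (a i - b i) * (\<Prod>j\<in>{..g} - {i}. b i - a j)"
    using inj_on_b i by (auto simp: residue_weight_def prod_dividef inj_on_def)
  also have "\<dots> = - (\<Prod>j\<le>g. b i - a j)"
    using i by (simp add: prod.remove[of _ i] algebra_simps)
  also have "of_real \<dots> = - poly A z"
    using i by (simp add: A_def poly_prod)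
  finally have "poly (\<Sum>k\<le>g. ?T k) z = - poly A z" .
  moreover have "poly B z = 0"
    using i by (simp add: poly_B_eq_0_iff)
  ultimately show "poly B z = poly (A + (\<Sum>k\<le>g. ?T k)) z"
    by simp
qed

lemma A_over_B:
  assumes "poly B z \<noteq> 0"
  shows "poly A z / poly B z = 1 - (\<Sum>i\<le>g. of_real (residue_weight i) / (z - of_real (b i)))"
proof -
  have "(\<Prod>j\<in>{..g} - {i}. z - of_real (b j)) = poly B z / (z - of_real (b i))" if "i \<le> g" for i
  proof -
    have "z - of_real (b i) \<noteq> 0"
      using assms that by (auto simp: poly_B_eq_0_iff)
    moreover have "poly B z = (z - of_real (b i)) * (\<Prod>j\<in>{..g} - {i}. z - of_real (b j))"
      using that prod.remove[of "{..g}" i "\<lambda>j. z - of_real (b j)"] by (simp add: B_def poly_prod)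
    ultimately show ?thesis
      by simp
  qed
  then have "(\<Sum>i\<le>g. of_real (residue_weight i) * (\<Prod>j\<in>{..g} - {i}. z - of_real (b j))) =
      (\<Sum>i\<le>g. of_real (residue_weight i) * (poly B z / (z - of_real (b i))))"
    by (intro sum.cong) auto
  moreover have "poly B z = poly A z +
      (\<Sum>i\<le>g. of_real (residue_weight i) * (\<Prod>j\<in>{..g} - {i}. z - of_real (b j)))"
    by (subst B_partial_fraction) (simp add: poly_sum poly_prod)
  ultimately have "poly B z = poly A z +
      (\<Sum>i\<le>g. of_real (residue_weight i) * (poly B z / (z - of_real (b i))))"
    by (simp only:)
  also have "(\<Sum>i\<le>g. of_real (residue_weight i) * (poly B z / (z - of_real (b i)))) =
      poly B z * (\<Sum>i\<le>g. of_real (residue_weight i) / (z - of_real (b i)))"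
    by (simp add: sum_distrib_left mult.commute)
  finally have "poly A z = poly B z * (1 - (\<Sum>i\<le>g. of_real (residue_weight i) / (z - of_real (b i))))"
    unfolding right_diff_distrib mult_1_right eq_diff_eq by (rule sym)
  then show ?thesis
    using assms by (metis nonzero_mult_div_cancel_left)
qed

text \<open>For real \<open>t\<close>, the imaginary part of \<open>- 1 / (z - t)\<close> is
  \<open>Im z\<close> divided by the squared modulus of \<open>z - t\<close>, and all weights are
  positive. The form \<open>k * Im z\<close> serves both half planes at once.\<close>

lemma Im_A_over_B:
  assumes "Im z \<noteq> 0"
  obtains k where "k > 0" "Im (poly A z / poly B z) = k * Im z"
proof
  let ?k = "\<Sum>i\<le>g. residue_weight i / (cmod (z - of_real (b i)))\<^sup>2"
  have z: "z \<noteq> of_real t" for t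
    using assms by auto
  show "?k > 0"
    by (intro sum_pos) (auto simp: residue_weight_pos z)
  have "poly B z \<noteq> 0"
    using z by (auto simp: poly_B_eq_0_iff)
  then have "Im (poly A z / poly B z) = (\<Sum>i\<le>g. - Im (of_real (residue_weight i) / (z - of_real (b i))))"
    by (subst A_over_B) (simp_all add: sum_negf)
  also have "\<dots> = (\<Sum>i\<le>g. residue_weight i / (cmod (z - of_real (b i)))\<^sup>2 * Im z)"
    by (simp add: Im_divide cmod_power2)
  finally show "Im (poly A z / poly B z) = ?k * Im z"
    by (simp add: sum_distrib_right)
qed

section \<open>The function \<open>2 (A + B) / (B - A)\<close> and its preimage of the interval from
  -2 to 2\<close>

lemma no_common_root: "poly A z = 0 \<Longrightarrow> poly B z \<noteq> 0"
  using a_neq_b by (auto simp: poly_A_eq_0_iff poly_B_eq_0_iff)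

text \<open>At \<open>b 0\<close> only \<open>B\<close> vanishes, so \<open>B - A\<close> is not
  zero. The leading terms cancel in \<open>B - A\<close> but not in \<open>A + B\<close>. A common
  zero of numerator and denominator would be one of \<open>A\<close> and \<open>B\<close>.\<close>

lemma
  shows B_minus_A_nonzero: "B - A \<noteq> 0"
    and degree_less: "degree (B - A) < degree (smult 2 (A + B))"
    and coprime_canonical: "coprime (smult 2 (A + B)) (B - A)"
proof -
  have B0: "poly B (of_real (b 0)) = 0"
    by (simp add: poly_B_eq_0_iff)
  then show nz: "B - A \<noteq> 0"
    using no_common_root by fastforce
  have "coeff (B - A) i = 0" if "i \<ge> Suc g" for i
    using that monic_A monic_B by (cases "i = Suc g") (auto simp: coeff_eq_0)
  then have "degree (B - A) < Suc g"
    using nz by (metis leading_coeff_0_iff not_le)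
  also have "coeff (smult 2 (A + B)) (Suc g) = 4"
    using monic_A monic_B by simp
  then have "Suc g \<le> degree (smult 2 (A + B))"
    by (metis le_degree zero_neq_numeral)
  finally show "degree (B - A) < degree (smult 2 (A + B))" .
  show "coprime (smult 2 (A + B)) (B - A)"
  proof (rule coprime_complex_polyI[OF nz])
    fix z assume "poly (smult 2 (A + B)) z = 0"
    then have "poly A z + poly B z = 0"
      by (simp only: poly_smult poly_add mult_eq_0_iff) simp
    then have "poly A z = - poly B z"
      by (simp only: eq_neg_iff_add_eq_0)
    then show "poly (B - A) z \<noteq> 0"
      using no_common_root[of z] by auto
  qed
qed

text \<open>In terms of \<open>w = A / B\<close> the function is the Moebius map
  \<open>2 (1 + w) / (1 - w)\<close>, which multiplies the imaginary part by the positive number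
  \<open>4 / (cmod (1 - w))\<^sup>2\<close>.\<close>

lemma Im_canonical:
  assumes "Im z \<noteq> 0"
  obtains k where "k > 0" "Im (poly (smult 2 (A + B)) z / poly (B - A) z) = k * Im z"
proof -
  define w where "w = poly A z / poly B z"
  obtain k where k: "k > 0" "Im w = k * Im z"
    using Im_A_over_B[OF assms] unfolding w_def by blast
  then have w: "w \<noteq> 1"
    using assms by auto
  have B: "poly B z \<noteq> 0"
    using assms by (auto simp: poly_B_eq_0_iff)
  then have A: "poly A z = w * poly B z"
    by (simp add: w_def)
  have "poly (smult 2 (A + B)) z = 2 * (1 + w) * poly B z" "poly (B - A) z = (1 - w) * poly B z"
    by (simp_all add: A algebra_simps)
  then have "poly (smult 2 (A + B)) z / poly (B - A) z = 2 * (1 + w) / (1 - w)"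
    using B by (simp only: nonzero_mult_divide_mult_cancel_right simp_thms)
  also have "2 * (1 + w) / (1 - w) = 2 * ((1 + w) * cnj (1 - w)) / of_real ((cmod (1 - w))\<^sup>2)"
    unfolding mult.assoc[symmetric] by (rule complex_div_cnj)
  also have "Im \<dots> = Im (2 * ((1 + w) * cnj (1 - w))) / (cmod (1 - w))\<^sup>2"
    by (rule Im_divide_of_real)
  also have "Im (2 * ((1 + w) * cnj (1 - w))) = 4 * Im w"
    by (simp add: algebra_simps)
  also have "4 * Im w / (cmod (1 - w))\<^sup>2 = 4 * k / (cmod (1 - w))\<^sup>2 * Im z"
    using k by simp
  finally show thesis
    by (rule that[rotated]) (use k w in simp)
qed

text \<open>The factor for \<open>j = 0\<close> is at most 0 exactly between the outer end points,
  and a factor with \<open>j > 0\<close> is negative exactly inside its gap. As the gaps are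
  disjoint, at most one of the latter is negative at \<open>x\<close>.\<close>

lemma prod_nonpos_iff: "(\<Prod>j\<le>g. (x - a j) * (x - b j)) \<le> 0 \<longleftrightarrow> x \<in> E"
proof -
  have set: "{1..g} = {..g} - {0}"
    by auto
  have split: "(\<Prod>j\<le>g. (x - a j) * (x - b j)) =
      (x - a 0) * (x - b 0) * (\<Prod>j\<in>{1..g}. (x - a j) * (x - b j))"
    unfolding set using prod.remove[of "{..g}" 0 "\<lambda>j. (x - a j) * (x - b j)"] by simp
  show ?thesis
  proof (cases "x \<in> E")
    case True
    have "(x - a j) * (x - b j) \<ge> 0" if "j \<in> {1..g}" for j
      using True that gap[of j] by (auto simp: in_E_iff zero_le_mult_iff dest!: bspec[of _ _ j])
    then have "(\<Prod>j\<in>{1..g}. (x - a j) * (x - b j)) \<ge> 0"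
      by (rule prod_nonneg)
    moreover have "(x - a 0) * (x - b 0) \<le> 0"
      using True by (auto simp: in_E_iff mult_le_0_iff)
    ultimately show ?thesis
      using True by (simp add: split mult_nonpos_nonneg)
  next
    case False
    then consider "x < b 0" | "a 0 < x"
      | k where "k \<in> {1..g}" "a k < x" "x < b k"
      using in_E_iff[of x] by (metis not_le)
    then have "(\<Prod>j\<le>g. (x - a j) * (x - b j)) > 0"
    proof cases
      case 1
      then have "(x - a j) * (x - b j) > 0" if "j \<le> g" for j
        using that ends gap[of j] inside[of j] by (cases "j = 0") (auto intro!: mult_neg_neg)
      then show ?thesis
        by (intro prod_pos) auto
    next
      case 2
      then have "(x - a j) * (x - b j) > 0" if "j \<le> g" for j
        using that ends gap[of j] inside[of j] by (cases "j = 0") (auto intro!: mult_pos_pos)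
      then show ?thesis
        by (intro prod_pos) auto
    next
      case 3
      have "(x - a j) * (x - b j) > 0" if "j \<in> {1..g} - {k}" for j
        using that 3 gap[of j] gap[of k] disjoint[of j k] by (auto simp: zero_less_mult_iff)
      then have "(\<Prod>j\<in>{1..g} - {k}. (x - a j) * (x - b j)) > 0"
        by (rule prod_pos)
      moreover have "(x - a k) * (x - b k) < 0"
        using 3 by (auto intro: mult_pos_neg)
      ultimately have "(\<Prod>j\<in>{1..g}. (x - a j) * (x - b j)) < 0"
        using 3 by (simp add: prod.remove[of _ k] mult_neg_pos)
      moreover have "(x - a 0) * (x - b 0) < 0"
        using 3 inside[of k] by (auto intro!: mult_neg_pos)
      ultimately show ?thesis
        by (simp add: split mult_neg_neg)
    qed
    then show ?thesis
      using False by simp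
  qed
qed

text \<open>The first conjunct excludes poles, where the quotient is 0 by convention and would be
  counted. Off the real axis both sides are false; on it, the bound amounts to
  \<open>\<alpha> * \<beta> \<le> 0\<close> for the values \<open>\<alpha>\<close> and
  \<open>\<beta>\<close> of \<open>A\<close> and \<open>B\<close>.\<close>

lemma canonical_preimage:
  "poly (B - A) z \<noteq> 0 \<and> poly (smult 2 (A + B)) z / poly (B - A) z \<in> of_real ` {-2..2} \<longleftrightarrow>
    z \<in> of_real ` E"
proof (cases "Im z = 0")
  case False
  then obtain k where "k > 0" "Im (poly (smult 2 (A + B)) z / poly (B - A) z) = k * Im z"
    using Im_canonical by blast
  then have "poly (smult 2 (A + B)) z / poly (B - A) z \<notin> \<real>"
    using False by (auto simp: complex_is_Real_iff)
  then show ?thesis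
    using False by auto
next
  case True
  define x where "x = Re z"
  have z: "z = of_real x"
    using True by (simp add: x_def complex_eq_iff)
  define \<alpha> \<beta> where "\<alpha> = (\<Prod>j\<le>g. x - a j)" and "\<beta> = (\<Prod>j\<le>g. x - b j)"
  have A: "poly A z = of_real \<alpha>" and B: "poly B z = of_real \<beta>"
    by (simp_all add: A_def B_def \<alpha>_def \<beta>_def z poly_prod)
  have "\<alpha> \<noteq> 0 \<or> \<beta> \<noteq> 0"
    using no_common_root[of z] A B by auto
  have mem: "complex_of_real t \<in> of_real ` {-2..2} \<longleftrightarrow> \<bar>t\<bar> \<le> 2" for t
    by (auto simp: abs_le_iff)
  have val: "poly (smult 2 (A + B)) z / poly (B - A) z = of_real (2 * (\<alpha> + \<beta>) / (\<beta> - \<alpha>))"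
    by (simp add: A B)
  have "poly (B - A) z \<noteq> 0 \<and> poly (smult 2 (A + B)) z / poly (B - A) z \<in> of_real ` {-2..2} \<longleftrightarrow>
      \<beta> \<noteq> \<alpha> \<and> \<bar>2 * (\<alpha> + \<beta>) / (\<beta> - \<alpha>)\<bar> \<le> 2"
    unfolding val mem by (simp add: A B)
  also have "\<dots> \<longleftrightarrow> \<beta> \<noteq> \<alpha> \<and> \<bar>\<alpha> + \<beta>\<bar> \<le> \<bar>\<beta> - \<alpha>\<bar>"
    by (cases "\<beta> = \<alpha>") (simp_all only: abs_divide abs_mult divide_le_eq, auto)
  also have "\<dots> \<longleftrightarrow> \<beta> \<noteq> \<alpha> \<and> \<alpha> * \<beta> \<le> 0"
    by (auto simp: abs_le_square_iff power2_eq_square algebra_simps)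
  \<comment> \<open>If \<open>\<alpha> = \<beta>\<close>, then
    \<open>\<alpha> * \<beta> \<le> 0\<close> would make both zero.\<close>
  also have "\<dots> \<longleftrightarrow> \<alpha> * \<beta> \<le> 0"
    using \<open>\<alpha> \<noteq> 0 \<or> \<beta> \<noteq> 0\<close> by (auto simp: mult_le_0_iff)
  also have "\<dots> \<longleftrightarrow> x \<in> E"
    by (simp add: \<alpha>_def \<beta>_def prod.distrib[symmetric] prod_nonpos_iff)
  finally show ?thesis
    by (auto simp: A B z)
qed

section \<open>Uniqueness\<close>

lemma rational_function_unique:
  fixes P Q :: "complex poly"
  assumes cop: "coprime P Q" and deg: "degree Q < degree P"
    and upper: "\<And>z. Im z > 0 \<Longrightarrow> Im (poly P z / poly Q z) > 0"
    and pre: "\<And>z. poly Q z \<noteq> 0 \<and> poly P z / poly Q z \<in> of_real ` {-2..2} \<longleftrightarrow> z \<in> of_real ` E"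
  shows "P * (B - A) = smult 2 (A + B) * Q"
proof -
  define f where "f x = Re (poly P (of_real x) / poly Q (of_real x))" for x :: real
  have "poly P (of_real x) / poly Q (of_real x) \<in> \<real>" if "x \<in> E" for x :: real
    using pre[of "of_real x"] that by auto
  then have "poly P (of_real x) / poly Q (of_real x) \<in> \<real>" for x :: real
    using rational_real_on_reals[OF infinite_E] by blast
  then have f: "poly P (of_real x) / poly Q (of_real x) = of_real (f x)" for x :: real
    by (simp add: f_def)
  have E: "x \<in> E \<longleftrightarrow> poly Q (of_real x) \<noteq> 0 \<and> -2 \<le> f x \<and> f x \<le> 2" for x
    using pre[of "of_real x"] by (auto simp: f image_iff)
  have incr: "order (of_real x) (P - smult (of_real (f x)) Q) = 1"
    "\<forall>\<^sub>F y in at_right x. f x < f y" "\<forall>\<^sub>F y in at_left x. f y < f x" if "x \<in> E" for x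
    using boundary_increasing[OF upper _ f, of x] that unfolding f_def by (auto simp: E)
  have cont: "(f \<longlongrightarrow> f x) (at x within S)" if "x \<in> E" for x S
    unfolding f_def by (rule tendsto_eq_intros refl | use that in \<open>simp add: E\<close>)+
  have pole_free: "\<forall>\<^sub>F y in at x within S. poly Q (of_real y) \<noteq> 0" if "x \<in> E" for x S
    using that by (intro tendsto_imp_eventually_ne[where c = "poly Q (of_real x)"])
      (auto simp: E intro!: tendsto_eq_intros)
  \<comment> \<open>Otherwise points just to the right of \<open>x\<close> would belong to
    \<open>E\<close> and yet have values above 2.\<close>
  have two: "x \<in> a ` {..g}" if "x \<in> E" "f x = 2" for x
  proof (rule ccontr)
    assume "x \<notin> a ` {..g}"
    from eventually_in_E_right[OF that(1) this] incr(2)[OF that(1)]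
    have "\<forall>\<^sub>F y in at_right x. False"
      by eventually_elim (use that in \<open>auto simp: E\<close>)
    then show False
      by simp
  qed
  have minus_two: "x \<in> b ` {..g}" if "x \<in> E" "f x = -2" for x
  proof (rule ccontr)
    assume "x \<notin> b ` {..g}"
    from eventually_in_E_left[OF that(1) this] incr(3)[OF that(1)]
    have "\<forall>\<^sub>F y in at_left x. False"
      by eventually_elim (use that in \<open>auto simp: E\<close>)
    then show False
      by simp
  qed
  \<comment> \<open>If the value at \<open>a j\<close> were below 2, points just to its right would
    still have values between -2 and 2 and no pole, hence lie in \<open>E\<close>, although a gap or
    the exterior begins there.\<close>
  have fa: "f (a j) = 2" if "j \<le> g" for j
  proof (rule ccontr)
    have aE: "a j \<in> E"
      using that by (rule a_in_E)
    assume "f (a j) \<noteq> 2"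
    then have "\<forall>\<^sub>F y in at_right (a j). f y < 2"
      using aE by (intro order_tendstoD(2)[OF cont]) (auto simp: E)
    then have "\<forall>\<^sub>F y in at_right (a j). False"
      using incr(2)[OF aE] pole_free[OF aE] eventually_notin_E_right[OF that]
      by eventually_elim (use aE in \<open>auto simp: E\<close>)
    then show False
      by simp
  qed
  have fb: "f (b j) = -2" if "j \<le> g" for j
  proof (rule ccontr)
    have bE: "b j \<in> E"
      using that by (rule b_in_E)
    assume "f (b j) \<noteq> -2"
    then have "\<forall>\<^sub>F y in at_left (b j). f y > -2"
      using bE by (intro order_tendstoD(1)[OF cont]) (auto simp: E)
    then have "\<forall>\<^sub>F y in at_left (b j). False"
      using incr(3)[OF bE] pole_free[OF bE] eventually_notin_E_left[OF that]
      by eventually_elim (use bE in \<open>auto simp: E\<close>)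
    then show False
      by simp
  qed
  \<comment> \<open>Nonreal zeros are excluded as well: by coprimality such a \<open>z\<close> is no
    pole, so \<open>P / Q\<close> takes the value \<open>c\<close> there and the preimage condition
    puts \<open>z\<close> in \<open>E\<close>.\<close>
  have root: "poly (P - smult (of_real c) Q) z = 0 \<longleftrightarrow> z \<in> of_real ` {x \<in> E. f x = c}"
    if "c \<in> {-2..2}" for c z
  proof
    assume "poly (P - smult (of_real c) Q) z = 0"
    then have Pz: "poly P z = of_real c * poly Q z"
      by simp
    then have Qz: "poly Q z \<noteq> 0"
      using coprime_poly_0[OF cop, of z] by auto
    then have eq: "poly P z / poly Q z = of_real c"
      using Pz by simp
    moreover from that have "complex_of_real c \<in> of_real ` {-2..2}"
      by (rule imageI)
    ultimately obtain x where "x \<in> E" "z = of_real x"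
      using pre[of z] Qz by auto
    then show "z \<in> of_real ` {x \<in> E. f x = c}"
      using f[of x] eq by auto
  next
    assume "z \<in> of_real ` {x \<in> E. f x = c}"
    then obtain x where "z = of_real x" "x \<in> E" "f x = c"
      by auto
    then show "poly (P - smult (of_real c) Q) z = 0"
      using f[of x] by (auto simp: E field_simps)
  qed
  \<comment> \<open>Independence of \<open>c\<close> yields the same factor \<open>k\<close> for
    \<open>c = 2\<close> and \<open>c = -2\<close>.\<close>
  have lead: "coeff (P - smult c Q) (degree P) = lead_coeff P" for c
    using deg by (simp add: coeff_eq_0)
  have degree: "degree (P - smult c Q) = degree P" for c
    using deg degree_smult_le[of c Q] degree_add_eq_left[of "- smult c Q" P] by simp
  have sqf: "rsquarefree (P - smult (of_real c) Q)" if "c \<in> {-2..2}" for c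
    unfolding rsquarefree_def
  proof (intro conjI allI)
    show "P - smult (of_real c) Q \<noteq> 0"
      using degree[of "of_real c"] deg by auto
    fix z
    show "order z (P - smult (of_real c) Q) = 0 \<or> order z (P - smult (of_real c) Q) = 1"
      using root[OF that, of z] incr(1) order_0I by blast
  qed
  define k where "k = lead_coeff P"
  have "k \<noteq> 0"
    using deg by (auto simp: k_def)
  have "{x \<in> E. f x = 2} = a ` {..g}" "{x \<in> E. f x = -2} = b ` {..g}"
    using two minus_two fa fb a_in_E b_in_E by auto
  then have "{z. poly (P - smult (of_real 2) Q) z = 0} = of_real ` a ` {..g}"
    "{z. poly (P - smult (of_real (-2)) Q) z = 0} = of_real ` b ` {..g}"
    using root[of 2] root[of "-2"] by auto
  then have "P - smult (of_real 2) Q = smult k A" "P - smult (of_real (-2)) Q = smult k B"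
    using rsquarefree_eq_A[OF sqf, of 2] rsquarefree_eq_B[OF sqf, of "-2"] lead degree
    by (simp_all only: k_def) auto
  then have "smult k A = P - smult 2 Q" "smult k B = P + smult 2 Q"
    by simp_all
  \<comment> \<open>Here \<open>k (B - A) = 4 Q\<close> and \<open>k (A + B) = 2 P\<close>, so after
    multiplication by \<open>k\<close> both sides of the claim are \<open>4 P Q\<close>.\<close>
  then have "smult k (P * (B - A)) = P * (P + smult 2 Q - (P - smult 2 Q))"
    "smult k (smult 2 (A + B) * Q) = smult 2 ((P - smult 2 Q) + (P + smult 2 Q)) * Q"
    by (metis mult_smult_right smult_diff_right, metis mult_smult_left smult_add_right smult_smult mult.commute)
  then have "smult k (P * (B - A)) = smult k (smult 2 (A + B) * Q)"
    by (simp add: algebra_simps)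
  then show ?thesis
    using \<open>k \<noteq> 0\<close> by (metis smult_cancel)
qed

end

section \<open>Existence and uniqueness on the Riemann sphere\<close>

theorem lemma1p8:
  fixes g :: nat and a b :: "nat \<Rightarrow> real" and E :: "real set"
  assumes "b 0 < a 0"
    and "\<And>j. j \<in> {1..g} \<Longrightarrow> a j < b j"
    and "\<And>j. j \<in> {1..g} \<Longrightarrow> closure {a j<..<b j} \<subseteq> {b 0<..<a 0}"
    and "\<And>i j. i \<in> {1..g} \<Longrightarrow> j \<in> {1..g} \<Longrightarrow> i \<noteq> j \<Longrightarrow>
           closure {a i<..<b i} \<inter> closure {a j<..<b j} = {}"
    and "E = {b 0..a 0} - (\<Union>j\<in>{1..g}. {a j<..<b j})"
  shows "\<exists>!\<Delta> :: complex poly fract.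
           sphere_map \<Delta> sphere_infinity = sphere_infinity \<and>
           real_to_sphere ` E = sphere_map \<Delta> -` (real_to_sphere ` {-2..2}) \<and>
           (\<forall>z. Im z > 0 \<longrightarrow> (\<exists>w. sphere_map \<Delta> (Some z) = Some w \<and> Im w > 0))"
proof -
  interpret interval_system g a b
  proof
    fix i j
    assume i: "0 < i" "i \<le> g" and j: "0 < j" "j \<le> g" "i \<noteq> j"
    have "{a i..b i} \<inter> {a j..b j} = {}" "a i < b i" "a j < b j"
      using assms(2)[of i] assms(2)[of j] assms(4)[of i j] i j by auto
    then show "b i < a j \<or> b j < a i"
      by (auto simp: disjoint_iff)
  next
    fix j
    assume j: "0 < j" "j \<le> g"
    then show "b 0 < a j \<and> b j < a 0"
      using assms(2)[of j] assms(3)[of j] by (auto simp: subset_iff)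
  qed (use assms in auto)
  have E: "E = local.E"
    using assms(5) by (simp add: E_def)
  define D where "D = quot_to_fract (smult 2 (A + B), B - A)"
  note eval = sphere_map_coprime[OF coprime_canonical B_minus_A_nonzero, folded D_def]
  show ?thesis
    unfolding E
  proof (rule ex1I[of _ D])
    have "sphere_map D z \<in> real_to_sphere ` {-2..2} \<longleftrightarrow> z \<in> real_to_sphere ` local.E" for z
    proof (cases z)
      case None
      then show ?thesis
        using eval(2)[OF degree_less] by auto
    next
      case (Some w)
      then show ?thesis
        using canonical_preimage[of w] eval(1)[of w] by auto
    qed
    then show "sphere_map D sphere_infinity = sphere_infinity \<and>
        real_to_sphere ` local.E = sphere_map D -` (real_to_sphere ` {-2..2}) \<and>
        (\<forall>z. Im z > 0 \<longrightarrow> (\<exists>w. sphere_map D (Some z) = Some w \<and> Im w > 0))"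
    proof (intro conjI allI impI)
      fix z assume z: "Im z > 0"
      then obtain k where "k > 0" "Im (poly (smult 2 (A + B)) z / poly (B - A) z) = k * Im z"
        using Im_canonical[of z] by auto
      then have "Im (poly (smult 2 (A + B)) z / poly (B - A) z) > 0"
        using z by simp
      \<comment> \<open>At a zero of \<open>B - A\<close> the quotient would be 0, with imaginary
        part 0.\<close>
      moreover from this have "poly (B - A) z \<noteq> 0"
        by (metis division_ring_divide_zero less_irrefl zero_complex.sel(2))
      ultimately show "\<exists>w. sphere_map D (Some z) = Some w \<and> Im w > 0"
        using eval(1)[of z] by auto
    qed (use eval(2)[OF degree_less] in auto)
  next
    fix R
    assume R: "sphere_map R sphere_infinity = sphere_infinity \<and>
        real_to_sphere ` local.E = sphere_map R -` (real_to_sphere ` {-2..2}) \<and>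
        (\<forall>z. Im z > 0 \<longrightarrow> (\<exists>w. sphere_map R (Some z) = Some w \<and> Im w > 0))"
    define P Q where "P = fst (quot_of_fract R)" and "Q = snd (quot_of_fract R)"
    have cop: "coprime P Q" and Q: "Q \<noteq> 0" and RPQ: "R = quot_to_fract (P, Q)"
      by (simp_all add: P_def Q_def coprime_quot_of_fract)
    have fin: "sphere_map R (Some z) =
        (if poly Q z = 0 then sphere_infinity else Some (poly P z / poly Q z))" for z
      unfolding RPQ by (rule sphere_map_coprime[OF cop Q])
    \<comment> \<open>Otherwise the value at infinity would be finite.\<close>
    have "degree Q < degree P"
      using R by (auto simp: sphere_map_def P_def Q_def split: prod.splits if_splits)
    moreover have "Im (poly P z / poly Q z) > 0" if "Im z > 0" for z
      using R that by (auto simp: fin split: if_splits)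
    moreover have "poly Q z \<noteq> 0 \<and> poly P z / poly Q z \<in> of_real ` {-2..2} \<longleftrightarrow>
        z \<in> of_real ` local.E" for z
    proof -
      have "z \<in> of_real ` local.E \<longleftrightarrow> Some z \<in> real_to_sphere ` local.E"
        by auto
      also have "\<dots> \<longleftrightarrow> sphere_map R (Some z) \<in> real_to_sphere ` {-2..2}"
        using R by (metis vimage_eq)
      also have "\<dots> \<longleftrightarrow> poly Q z \<noteq> 0 \<and> poly P z / poly Q z \<in> of_real ` {-2..2}"
        by (auto simp: fin)
      finally show ?thesis
        by simp
    qed
    ultimately have "P * (B - A) = smult 2 (A + B) * Q"
      by (intro rational_function_unique[OF cop])
    then show "R = D"
      using Q B_minus_A_nonzero by (simp add: RPQ D_def quot_to_fract_def eq_fract)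
  qed
qed

end
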